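(* Let $\mathcal A$ be any Monte Carlo algorithm in the beeping model $BL$ which detects collision in wheels. If $\mathcal A$ halts (on wheels with $n$ nodes, in the situations described in the context) in less than $(\log n)/2$ slots with probability greater than $3/4$, then for some situations in some wheels, $\mathcal A$ gives incorrect results for some nodes with probability greater than $1/4$. Here $\log$ is the binary logarithm.
   Context: Beeping model $BL$: the network is a finite simple undirected graph; nodes are anonymous (a node's behaviour depends only on its initial state, its independent random choices and what it hears), run the same randomised algorithm, and start in the same slot. In each synchronous slot every active node either beeps or listens. A beeping node gets no information about other beeps in that slot; a listening node learns only whether at least one neighbour beeped. Wheels: for positive integers $m,s$, an $(m,s)$-wheel is a graph with vertices $u_1,\dots,u_{4ms}$ (so $n=4ms$) whose edges are all $(u_{i-1},u_i)$ (indices modulo $4ms$) plus $m$ spokes, i.e. edges $(u_{is},u_{(i+2m)s})$ with $1\le i\le 2m$, where either all odd $i$ are used (odd wheel) or all even $i$ are used (even wheel). Situations: all vertices $u_{is}$, $1\le i\le 4m$, are in the same initial state, a state in which they wish to beep; all other vertices are in another common initial state, in which they do not wish to beep. The correct result of collision detection is that the vertices at the ends of spokes, and no others, conclude that there is a collision. *)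

theory Defs
  imports "HOL-Probability.Probability"
begin

section \<open>The beeping model\<close>

text \<open>
  \<open>Halt b\<close> means that the node stops with result \<open>b\<close>, where \<open>True\<close> stands for
  ``there is a collision''. A halted node is no longer active and hence silent.
\<close>

datatype action = Beep | Listen | Halt bool

text \<open>
  The perception of a node in one slot is \<open>None\<close> if it beeped (it learns nothing), and
  \<open>Some b\<close> if it listened, where \<open>b\<close> tells whether at least one neighbour beeped.

  An algorithm is given in full-information form. All the random choices of a node are
  collected in one sample from the probability space \<open>tape\<close> (for instance an infinite
  sequence of coin flips); the next action of a node is a function of its initial state,
  its own sample, and the list of its perceptions so far, oldest first.
\<close>

record ('s, 'r) beep_alg =
  tape :: "'r measure"
  act :: "'s \<Rightarrow> 'r \<Rightarrow> bool option list \<Rightarrow> action"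

definition beeping_algorithm :: "('s, 'r) beep_alg \<Rightarrow> bool" where
  "beeping_algorithm A \<longleftrightarrow>
     prob_space (tape A) \<and>
     (\<forall>x h. (\<lambda>r. act A x r h) \<in> measurable (tape A) (count_space UNIV))"

text \<open>
  Below, \<open>E\<close> is the edge set of a graph, \<open>ini\<close> assigns the initial states, and \<open>\<omega>\<close> the
  samples. \<open>perceived A E ini \<omega> t v\<close> is the list of perceptions of \<open>v\<close> after \<open>t\<close> slots; it
  stops growing once \<open>v\<close> has halted.
\<close>

primrec perceived ::
  "('s, 'r) beep_alg \<Rightarrow> 'v set set \<Rightarrow> ('v \<Rightarrow> 's) \<Rightarrow> ('v \<Rightarrow> 'r) \<Rightarrow> nat \<Rightarrow> 'v \<Rightarrow> bool option list"
where
  "perceived A E ini \<omega> 0 = (\<lambda>v. [])"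
| "perceived A E ini \<omega> (Suc t) = (\<lambda>v.
     let h = perceived A E ini \<omega> t in
     case act A (ini v) (\<omega> v) (h v) of
       Beep \<Rightarrow> h v @ [None]
     | Listen \<Rightarrow> h v @ [Some (\<exists>w. {v, w} \<in> E \<and> act A (ini w) (\<omega> w) (h w) = Beep)]
     | Halt b \<Rightarrow> h v)"

definition halted_with ::
  "('s, 'r) beep_alg \<Rightarrow> 'v set set \<Rightarrow> ('v \<Rightarrow> 's) \<Rightarrow> ('v \<Rightarrow> 'r) \<Rightarrow> nat \<Rightarrow> 'v \<Rightarrow> bool \<Rightarrow> bool"
where
  "halted_with A E ini \<omega> t v b \<longleftrightarrow>
     act A (ini v) (\<omega> v) (perceived A E ini \<omega> t v) = Halt b"

text \<open>The nodes' random choices are independent and identically distributed.\<close>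

definition choices :: "('s, 'r) beep_alg \<Rightarrow> 'v set \<Rightarrow> ('v \<Rightarrow> 'r) measure" where
  "choices A V = PiM V (\<lambda>_. tape A)"

definition halts_in_less_than ::
  "real \<Rightarrow> ('s, 'r) beep_alg \<Rightarrow> 'v set \<Rightarrow> 'v set set \<Rightarrow> ('v \<Rightarrow> 's) \<Rightarrow> ('v \<Rightarrow> 'r) \<Rightarrow> bool"
where
  "halts_in_less_than \<tau> A V E ini \<omega> \<longleftrightarrow>
     (\<exists>t. real t < \<tau> \<and> (\<forall>v\<in>V. \<exists>b. halted_with A E ini \<omega> t v b))"

text \<open>
  \<open>C\<close> is the set of nodes that ought to conclude that there is a collision. A node which
  never halts gives no result, hence does not count as giving an incorrect one.
\<close>

definition some_incorrect_result ::
  "'v set \<Rightarrow> ('s, 'r) beep_alg \<Rightarrow> 'v set \<Rightarrow> 'v set set \<Rightarrow> ('v \<Rightarrow> 's) \<Rightarrow> ('v \<Rightarrow> 'r) \<Rightarrow> bool"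
where
  "some_incorrect_result C A V E ini \<omega> \<longleftrightarrow>
     (\<exists>v\<in>V. \<exists>t b. halted_with A E ini \<omega> t v b \<and> b \<noteq> (v \<in> C))"


section \<open>Wheels\<close>

text \<open>
  The vertex \<open>u\<^sub>j\<close> is represented by \<open>j mod 4ms\<close>, so \<open>u\<^bsub>4ms\<^esub>\<close> is the number \<open>0\<close>.
  The parameter \<open>par\<close> is meant to be \<open>odd\<close> (odd wheels) or \<open>even\<close> (even wheels).
\<close>

definition wheel_verts :: "nat \<Rightarrow> nat \<Rightarrow> nat set" where
  "wheel_verts m s = {..<4 * m * s}"

definition spokes :: "(nat \<Rightarrow> bool) \<Rightarrow> nat \<Rightarrow> nat \<Rightarrow> nat set set" where
  "spokes par m s =
     {{(i * s) mod (4 * m * s), ((i + 2 * m) * s) mod (4 * m * s)} | i.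
        1 \<le> i \<and> i \<le> 2 * m \<and> par i}"

definition wheel_edges :: "(nat \<Rightarrow> bool) \<Rightarrow> nat \<Rightarrow> nat \<Rightarrow> nat set set" where
  "wheel_edges par m s =
     {{(i - 1) mod (4 * m * s), i mod (4 * m * s)} | i. 1 \<le> i \<and> i \<le> 4 * m * s}
     \<union> spokes par m s"

text \<open>The vertices \<open>u\<^bsub>is\<^esub>\<close> with \<open>1 \<le> i \<le> 4m\<close> start in state \<open>p\<close>, the others in state \<open>q\<close>.\<close>

definition wheel_init :: "'s \<Rightarrow> 's \<Rightarrow> nat \<Rightarrow> nat \<Rightarrow> nat \<Rightarrow> 's" where
  "wheel_init p q m s v =
     (if v \<in> {(i * s) mod (4 * m * s) | i. 1 \<le> i \<and> i \<le> 4 * m} then p else q)"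

definition prob_wheel_halts ::
  "real \<Rightarrow> ('s, 'r) beep_alg \<Rightarrow> 's \<Rightarrow> 's \<Rightarrow> (nat \<Rightarrow> bool) \<Rightarrow> nat \<Rightarrow> nat \<Rightarrow> real"
where
  "prob_wheel_halts \<tau> A p q par m s =
     \<P>(\<omega> in choices A (wheel_verts m s).
        halts_in_less_than \<tau> A (wheel_verts m s) (wheel_edges par m s) (wheel_init p q m s) \<omega>)"

definition prob_wheel_incorrect ::
  "('s, 'r) beep_alg \<Rightarrow> 's \<Rightarrow> 's \<Rightarrow> (nat \<Rightarrow> bool) \<Rightarrow> nat \<Rightarrow> nat \<Rightarrow> real"
where
  "prob_wheel_incorrect A p q par m s =
     \<P>(\<omega> in choices A (wheel_verts m s).
        some_incorrect_result (\<Union> (spokes par m s))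
          A (wheel_verts m s) (wheel_edges par m s) (wheel_init p q m s) \<omega>)"

end

theory Submission
  imports Defs
begin

text \<open>
  Take \<open>s = 2^a\<close> with \<open>a\<close> large, \<open>n = 4ms = 2^s\<close> and \<open>T = s/2 - 1\<close>, the last slot before \<open>(log n)/2\<close>,
  and consider the odd wheel. Since \<open>2T < s\<close>, the vertices within distance \<open>T\<close> of distinct \<open>u\<^bsub>is\<^esub>\<close>
  are disjoint stretches of the rim, on which the algorithm would run independently and
  identically if there were no spokes.

  A vertex \<open>u\<^bsub>is\<^esub>\<close> without a spoke halts by time \<open>T\<close> with probability above \<open>3/4\<close>. If it reports a
  collision with probability above \<open>1/4\<close>, this is already the required error. Otherwise the
  spokeless run reports ``no collision'' with probability above \<open>1/2\<close>. It has at most \<open>2^T\<close>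
  beeping patterns, so by Cauchy--Schwarz the two ends of a given spoke, run without the spoke,
  both report this after beeping in the same slots with probability at least \<open>2^-(T+2)\<close>. In that
  event the spoke transmits nothing, and the ends are wrong. As \<open>m \<ge> 2^(T+2)\<close>, this happens at
  one of the \<open>m\<close> independent spokes with probability at least \<open>1/2\<close>.
\<close>

section \<open>Locality of runs\<close>

lemma halted_with_mono:
  assumes "halted_with A E ini \<omega> t v b" "t \<le> t'"
  shows "halted_with A E ini \<omega> t' v b"
  using assms(2,1)
  by (induction t' rule: dec_induct) (auto simp: halted_with_def Let_def)

definition beeps ::
  "('s, 'r) beep_alg \<Rightarrow> 'v set set \<Rightarrow> ('v \<Rightarrow> 's) \<Rightarrow> ('v \<Rightarrow> 'r) \<Rightarrow> nat \<Rightarrow> 'v \<Rightarrow> bool"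
where
  "beeps A E ini \<omega> t v \<longleftrightarrow> act A (ini v) (\<omega> v) (perceived A E ini \<omega> t v) = Beep"

text \<open>
  The maps \<open>\<phi> b\<close> place copies of a graph \<open>E\<close> into \<open>E'\<close>; \<open>d\<close> measures the distance from the
  centre of a copy. An additional edge of \<open>E'\<close> between corresponding vertices which beep in the
  same slots is never heard: whenever one end listens, the other one is silent.
\<close>

lemma perceived_local:
  assumes ini: "\<And>b u. b \<in> K \<Longrightarrow> d u \<le> T \<Longrightarrow> ini' (\<phi> b u) = ini u"
    and om: "\<And>b u. b \<in> K \<Longrightarrow> d u \<le> T \<Longrightarrow> \<omega>' (\<phi> b u) = \<omega> b u"
    and dist: "\<And>u u'. {u, u'} \<in> E \<Longrightarrow> d u' \<le> Suc (d u)"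
    and hom: "\<And>b u u'. b \<in> K \<Longrightarrow> d u < T \<Longrightarrow> {u, u'} \<in> E \<Longrightarrow> {\<phi> b u, \<phi> b u'} \<in> E'"
    and lift: "\<And>b u w. b \<in> K \<Longrightarrow> d u < T \<Longrightarrow> {\<phi> b u, w} \<in> E' \<Longrightarrow>
        (\<exists>u'. {u, u'} \<in> E \<and> w = \<phi> b u') \<or>
        (\<exists>b'\<in>K. w = \<phi> b' u \<and>
           (\<forall>t<T. beeps A E ini (\<omega> b') t u \<longleftrightarrow> beeps A E ini (\<omega> b) t u))"
    and "b \<in> K" "d u + t \<le> T"
  shows "perceived A E' ini' \<omega>' t (\<phi> b u) = perceived A E ini (\<omega> b) t u"
  using assms(6,7)
\<comment> \<open>Information crosses one edge per slot, so slot \<open>t\<close> at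
  \<open>u\<close> needs the histories of neighbours one step further out. The budget
  \<open>d u + t \<le> T\<close> pays for that step; \<open>b\<close> is generalised because extra
  edges lead to other copies.\<close>
proof (induction t arbitrary: b u)
  case 0
  then show ?case by simp
next
  case (Suc t)
  have act_eq: "act A (ini' (\<phi> c x)) (\<omega>' (\<phi> c x)) (perceived A E' ini' \<omega>' t (\<phi> c x)) =
      act A (ini x) (\<omega> c x) (perceived A E ini (\<omega> c) t x)" if "c \<in> K" "d x + t \<le> T" for c x
    using Suc.IH[OF that] ini[of c x] om[of c x] that by simp
  have hist: "perceived A E' ini' \<omega>' t (\<phi> b u) = perceived A E ini (\<omega> b) t u"
    using Suc by simp
  have "(\<exists>w. {\<phi> b u, w} \<in> E' \<and>
          act A (ini' w) (\<omega>' w) (perceived A E' ini' \<omega>' t w) = Beep) \<longleftrightarrow>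
        (\<exists>w. {u, w} \<in> E \<and> act A (ini w) (\<omega> b w) (perceived A E ini (\<omega> b) t w) = Beep)"
    (is "?L \<longleftrightarrow> ?R")
    if listen: "act A (ini u) (\<omega> b u) (perceived A E ini (\<omega> b) t u) = Listen"
  proof
    assume ?L
    then obtain w where w: "{\<phi> b u, w} \<in> E'"
      "act A (ini' w) (\<omega>' w) (perceived A E' ini' \<omega>' t w) = Beep" by blast
    from Suc.prems lift[OF _ _ w(1)]
    consider u' where "{u, u'} \<in> E" "w = \<phi> b u'"
      | b' where "b' \<in> K" "w = \<phi> b' u" "beeps A E ini (\<omega> b') t u \<longleftrightarrow> beeps A E ini (\<omega> b) t u"
      by fastforce
    then show ?R
    proof cases
      case 1
      then have "d u' + t \<le> T" using dist[of u u'] Suc.prems by simp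
      then show ?thesis using 1 w(2) act_eq[of b u'] Suc.prems by auto
    next
      case 2
      then show ?thesis using w(2) act_eq[of b' u] Suc.prems listen by (simp add: beeps_def)
    qed
  next
    assume ?R
    then obtain u' where u': "{u, u'} \<in> E"
      "act A (ini u') (\<omega> b u') (perceived A E ini (\<omega> b) t u') = Beep" by blast
    then have "d u' + t \<le> T" using dist[of u u'] Suc.prems by simp
    then show ?L using u' hom[of b u u'] act_eq[of b u'] Suc.prems by auto
  qed
  then show ?case
    using act_eq[of b u] hist Suc.prems by (simp add: Let_def split: action.split)
qed

section \<open>Measurability of histories, verdicts and beeps\<close>

lemma measurable_act:
  assumes "beeping_algorithm A"
    and "g \<in> PiM V (\<lambda>_. tape A) \<rightarrow>\<^sub>M count_space (UNIV :: bool option list set)"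
  shows "(\<lambda>\<omega>. act A x (\<omega> v) (g \<omega>)) \<in> PiM V (\<lambda>_. tape A) \<rightarrow>\<^sub>M count_space UNIV"
\<comment> \<open>Histories form a countable type, so it is enough to treat each fixed history
  \<open>h\<close>.\<close>
proof (rule measurable_compose_countable[OF _ assms(2)])
  fix h
  have act: "(\<lambda>r. act A x r h) \<in> tape A \<rightarrow>\<^sub>M count_space UNIV"
    using assms(1) by (simp add: beeping_algorithm_def)
  show "(\<lambda>\<omega>. act A x (\<omega> v) h) \<in> PiM V (\<lambda>_. tape A) \<rightarrow>\<^sub>M count_space UNIV"
  proof (cases "v \<in> V")
    case True
    show ?thesis
      by (rule measurable_compose[OF measurable_component_singleton[OF True] act])
  next
    case False
    \<comment> \<open>Points of the product are extensional, so a vertex outside \<open>V\<close>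
      has the fixed sample \<open>undefined\<close>. Thus a run on the infinite path is measurable
      in finitely many samples.\<close>
    then have "\<And>\<omega>. \<omega> \<in> space (PiM V (\<lambda>_. tape A)) \<Longrightarrow> act A x (\<omega> v) h = act A x undefined h"
      by (auto simp: space_PiM PiE_def extensional_def)
    then show ?thesis
      by (subst measurable_cong[where g = "\<lambda>_. act A x undefined h"]) auto
  qed
qed

lemma measurable_perceived:
  fixes V :: "'v::countable set"
  assumes "beeping_algorithm A"
  shows "(\<lambda>\<omega>. perceived A E ini \<omega> t v) \<in> PiM V (\<lambda>_. tape A) \<rightarrow>\<^sub>M count_space UNIV"
proof (induction t arbitrary: v)
  case 0
  then show ?case by simp
next
  case (Suc t)
  let ?a = "\<lambda>\<omega> v. act A (ini v) (\<omega> v) (perceived A E ini \<omega> t v)"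
  note [measurable] = Suc.IH measurable_act[OF assms Suc.IH]
  \<comment> \<open>The recursion step with \<open>case\<close> replaced by tests. Vertices are
    countable, so the existential over \<open>w\<close> is a countable union of events.\<close>
  have "(\<lambda>\<omega>. if ?a \<omega> v = Beep then perceived A E ini \<omega> t v @ [None]
      else if ?a \<omega> v = Listen then
        perceived A E ini \<omega> t v @ [Some (\<exists>w. {v, w} \<in> E \<and> ?a \<omega> w = Beep)]
      else perceived A E ini \<omega> t v) \<in> PiM V (\<lambda>_. tape A) \<rightarrow>\<^sub>M count_space UNIV"
    by measurable
  also have "?this \<longleftrightarrow> ?case"
    by (intro arg_cong2[where f = "(\<in>)"] refl ext)
      (simp add: Let_def split: action.split)
  finally show ?case .
qed

lemma measurable_halted_with:
  fixes V :: "'v::countable set"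
  assumes "beeping_algorithm A"
  shows "Measurable.pred (PiM V (\<lambda>_. tape A)) (\<lambda>\<omega>. halted_with A E ini \<omega> t v b)"
  unfolding halted_with_def
  using measurable_act[OF assms measurable_perceived[OF assms]] by measurable

lemma measurable_beeps:
  fixes V :: "'v::countable set"
  assumes "beeping_algorithm A"
  shows "Measurable.pred (PiM V (\<lambda>_. tape A)) (\<lambda>\<omega>. beeps A E ini \<omega> t v)"
  unfolding beeps_def
  using measurable_act[OF assms measurable_perceived[OF assms]] by measurable

section \<open>Agreement of independent pairs\<close>

text \<open>The event is the disjoint union over \<sigma> of the events that both variables equal
  \<sigma>; independence gives each of these probability
  \<open>(\<mu> \<sigma>)\<^sup>2\<close>.\<close>

lemma (in prob_space) prob_agree:
  fixes X :: "'i \<Rightarrow> 'a \<Rightarrow> 'c"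
  assumes ind: "indep_vars (\<lambda>_. count_space UNIV) X {i, j}" and "i \<noteq> j" and "finite S"
    and \<mu>: "\<And>\<sigma>. prob (X i -` {\<sigma>} \<inter> space M) = \<mu> \<sigma>" "\<And>\<sigma>. prob (X j -` {\<sigma>} \<inter> space M) = \<mu> \<sigma>"
  shows "prob {\<omega>\<in>space M. X i \<omega> = X j \<omega> \<and> X i \<omega> \<in> S} = (\<Sum>\<sigma>\<in>S. (\<mu> \<sigma>)\<^sup>2)"
proof -
  have rv [measurable]: "X i \<in> M \<rightarrow>\<^sub>M count_space UNIV" "X j \<in> M \<rightarrow>\<^sub>M count_space UNIV"
    using ind by (auto simp: indep_vars_def)
  let ?B = "\<lambda>\<sigma>. (\<Inter>k\<in>{i, j}. X k -` {\<sigma>} \<inter> space M)"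
  have "?B \<sigma> \<in> events" for \<sigma>
    using rv by (auto intro!: measurable_sets[where A = "count_space UNIV"] sets.Int)
  moreover have "disjoint_family_on ?B S"
    by (auto simp: disjoint_family_on_def)
  ultimately have "prob (\<Union>\<sigma>\<in>S. ?B \<sigma>) = (\<Sum>\<sigma>\<in>S. prob (?B \<sigma>))"
    using \<open>finite S\<close> by (intro finite_measure_finite_Union) auto
  also have "\<dots> = (\<Sum>\<sigma>\<in>S. (\<mu> \<sigma>)\<^sup>2)"
  proof (rule sum.cong[OF refl])
    fix \<sigma>
    have "prob (?B \<sigma>) = (\<Prod>k\<in>{i, j}. prob (X k -` {\<sigma>} \<inter> space M))"
      by (rule indep_varsD[OF ind]) auto
    then show "prob (?B \<sigma>) = (\<mu> \<sigma>)\<^sup>2"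
      using \<open>i \<noteq> j\<close> by (simp add: \<mu> power2_eq_square)
  qed
  also have "(\<Union>\<sigma>\<in>S. ?B \<sigma>) = {\<omega>\<in>space M. X i \<omega> = X j \<omega> \<and> X i \<omega> \<in> S}"
    by auto
  finally show ?thesis .
qed

text \<open>The pairs use disjoint sets of variables, so their agreements are independent; the
  complement is the event that all of them fail.\<close>

lemma (in prob_space) prob_some_pair_agrees:
  fixes X :: "'i \<Rightarrow> 'a \<Rightarrow> 'c::countable" and a b :: "'k \<Rightarrow> 'i"
  assumes ind: "indep_vars (\<lambda>_. count_space UNIV) X I"
    and L: "finite L" "\<And>k. k \<in> L \<Longrightarrow> a k \<in> I \<and> b k \<in> I \<and> a k \<noteq> b k"
      "disjoint_family_on (\<lambda>k. {a k, b k}) L"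
    and "finite S" and \<mu>: "\<And>i \<sigma>. i \<in> I \<Longrightarrow> prob (X i -` {\<sigma>} \<inter> space M) = \<mu> \<sigma>"
  shows "prob {\<omega>\<in>space M. \<exists>k\<in>L. X (a k) \<omega> = X (b k) \<omega> \<and> X (a k) \<omega> \<in> S} =
    1 - (1 - (\<Sum>\<sigma>\<in>S. (\<mu> \<sigma>)\<^sup>2)) ^ card L"
proof (cases "L = {}")
  case False
  let ?agree = "\<lambda>k x. x (a k) = x (b k) \<and> x (a k) \<in> S"
  let ?P = "\<lambda>k. PiM {a k, b k} (\<lambda>_. count_space (UNIV :: 'c set))"
  let ?Z = "\<lambda>k \<omega>. restrict (\<lambda>i. X i \<omega>) {a k, b k}"
  define N where "N = (\<lambda>k. {\<omega>\<in>space M. X (a k) \<omega> = X (b k) \<omega> \<and> X (a k) \<omega> \<in> S})"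
  have rv [measurable]: "X i \<in> M \<rightarrow>\<^sub>M count_space UNIV" if "i \<in> I" for i
    using ind that by (auto simp: indep_vars_def)
  have N_ev: "N k \<in> events" if "k \<in> L" for k
  proof -
    have [measurable]: "a k \<in> I" "b k \<in> I" using L(2) that by auto
    show ?thesis unfolding N_def by measurable
  qed
  have indZ: "indep_vars ?P ?Z L"
    using L by (intro indep_vars_restrict[OF ind]) auto
  have meas: "{x \<in> space (?P k). \<not> ?agree k x} \<in> sets (?P k)" for k
  proof -
    have [measurable]: "(\<lambda>x. x (a k)) \<in> ?P k \<rightarrow>\<^sub>M count_space UNIV"
      "(\<lambda>x. x (b k)) \<in> ?P k \<rightarrow>\<^sub>M count_space UNIV"
      by (auto intro: measurable_component_singleton)
    show ?thesis by measurable
  qed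
  have compl: "?Z k -` {x \<in> space (?P k). \<not> ?agree k x} \<inter> space M = space M - N k" for k
    by (auto simp: N_def space_PiM)
  have "prob (\<Inter>k\<in>L. space M - N k) = (\<Prod>k\<in>L. prob (space M - N k))"
    using indep_varsD[OF indZ False \<open>finite L\<close> subset_refl meas] unfolding compl .
  also have "\<dots> = (\<Prod>k\<in>L. 1 - (\<Sum>\<sigma>\<in>S. (\<mu> \<sigma>)\<^sup>2))"
  proof (rule prod.cong[OF refl])
    fix k assume "k \<in> L"
    then have k: "a k \<in> I" "b k \<in> I" "a k \<noteq> b k" using L(2) by auto
    have "prob (N k) = (\<Sum>\<sigma>\<in>S. (\<mu> \<sigma>)\<^sup>2)"
      unfolding N_def using k \<mu> \<open>finite S\<close>
      by (intro prob_agree indep_vars_subset[OF ind]) auto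
    then show "prob (space M - N k) = 1 - (\<Sum>\<sigma>\<in>S. (\<mu> \<sigma>)\<^sup>2)"
      using N_ev[OF \<open>k \<in> L\<close>] by (simp add: prob_compl)
  qed
  finally have "prob (space M - (\<Union>k\<in>L. N k)) = (1 - (\<Sum>\<sigma>\<in>S. (\<mu> \<sigma>)\<^sup>2)) ^ card L"
    using False by simp
  moreover have "(\<Union>k\<in>L. N k) \<in> events"
    using N_ev \<open>finite L\<close> by auto
  ultimately have "prob (\<Union>k\<in>L. N k) = 1 - (1 - (\<Sum>\<sigma>\<in>S. (\<mu> \<sigma>)\<^sup>2)) ^ card L"
    using prob_compl[of "\<Union>k\<in>L. N k"] by simp
  moreover have "(\<Union>k\<in>L. N k) =
      {\<omega>\<in>space M. \<exists>k\<in>L. X (a k) \<omega> = X (b k) \<omega> \<and> X (a k) \<omega> \<in> S}"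
    by (auto simp: N_def)
  ultimately show ?thesis by simp
qed simp

text \<open>Bernoulli gives \<open>1 + m x \<le> (1 + x)^m\<close>, and
  \<open>(1 - x)^m (1 + x)^m = (1 - x^2)^m \<le> 1\<close>. The factor \<open>1 + m x\<close> is at
  least 2.\<close>

lemma one_minus_power_le_half:
  fixes x :: real
  assumes "0 \<le> x" "x \<le> 1" "real m * x \<ge> 1"
  shows "(1 - x) ^ m \<le> 1 / 2"
proof -
  have "(1 - x) ^ m * (1 + real m * x) \<le> (1 - x) ^ m * (1 + x) ^ m"
    using assms by (intro mult_left_mono Bernoulli_inequality) auto
  also have "\<dots> = (1 - x\<^sup>2) ^ m"
    by (simp flip: power_mult_distrib add: algebra_simps power2_eq_square)
  also have "\<dots> \<le> 1"
    using assms by (intro power_le_one) (auto simp: power_le_one)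
  finally have "(1 - x) ^ m * (1 + real m * x) \<le> 1" .
  moreover have "(1 - x) ^ m * 2 \<le> (1 - x) ^ m * (1 + real m * x)"
    using assms by (intro mult_left_mono) auto
  ultimately show ?thesis by simp
qed

section \<open>Independence and common law of windows of a product space\<close>

lemma indep_vars_windows:
  fixes M :: "'r measure" and \<phi> :: "'i \<Rightarrow> 'u \<Rightarrow> 'v"
  assumes "prob_space M" and "V \<noteq> {}"
    and sub: "\<And>i. i \<in> I \<Longrightarrow> \<phi> i ` D \<subseteq> V"
    and disj: "disjoint_family_on (\<lambda>i. \<phi> i ` D) I"
  shows "prob_space.indep_vars (PiM V (\<lambda>_. M)) (\<lambda>_. PiM D (\<lambda>_. M)) (\<lambda>i \<omega>. \<lambda>u\<in>D. \<omega> (\<phi> i u)) I"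
proof -
  interpret V: product_prob_space "\<lambda>_. M" V
    using assms(1) by (simp add: product_prob_space_def product_sigma_finite_def
      product_prob_space_axioms_def prob_space_imp_sigma_finite)
  \<comment> \<open>The coordinates are independent because their joint law, that of the identity
    map, is the product of their marginals.\<close>
  have "V.indep_vars (\<lambda>_. M) (\<lambda>v \<omega>. \<omega> v) V"
  proof -
    have "distr (PiM V (\<lambda>_. M)) (PiM V (\<lambda>_. M)) (\<lambda>\<omega>. \<lambda>v\<in>V. \<omega> v) =
        distr (PiM V (\<lambda>_. M)) (PiM V (\<lambda>_. M)) (\<lambda>\<omega>. \<omega>)"
      by (rule distr_cong) (auto simp: space_PiM)
    also have "\<dots> = PiM V (\<lambda>v. distr (PiM V (\<lambda>_. M)) M (\<lambda>\<omega>. \<omega> v))"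
      using V.PiM_component by (auto intro!: PiM_cong)
    finally show ?thesis
      using \<open>V \<noteq> {}\<close> by (subst V.indep_vars_iff_distr_eq_PiM') auto
  qed
  then have "V.indep_vars (\<lambda>i. PiM (\<phi> i ` D) (\<lambda>_. M)) (\<lambda>i \<omega>. restrict (\<lambda>v. \<omega> v) (\<phi> i ` D)) I"
    using V.indep_vars_restrict[OF _ sub disj] by simp
  \<comment> \<open>Reindexing along \<open>\<phi> i\<close> moves every block to the common index
    set \<open>D\<close>, so that one function can be applied to all windows.\<close>
  then have "V.indep_vars (\<lambda>_. PiM D (\<lambda>_. M))
      (\<lambda>i \<omega>. \<lambda>u\<in>D. restrict \<omega> (\<phi> i ` D) (\<phi> i u)) I"
  proof (rule V.indep_vars_compose2[where Y = "\<lambda>i \<eta>. \<lambda>u\<in>D. \<eta> (\<phi> i u)"])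
    show "(\<lambda>\<eta>. \<lambda>u\<in>D. \<eta> (\<phi> i u)) \<in> PiM (\<phi> i ` D) (\<lambda>_. M) \<rightarrow>\<^sub>M PiM D (\<lambda>_. M)" for i
      by (intro measurable_restrict measurable_component_singleton) simp
  qed
  then show ?thesis
    by (rule iffD1[OF V.indep_vars_cong, rotated -1])
      (auto intro!: ext simp: restrict_def)
qed

text \<open>Injective reindexing pushes a product of identical factors forward to such a product
  over \<open>D\<close>, so the law seen through a window does not depend on where the window
  lies.\<close>

lemma prob_window:
  fixes M :: "'r measure"
  assumes "prob_space M" "inj_on f D" "f ` D \<subseteq> V"
    and "g \<in> PiM D (\<lambda>_. M) \<rightarrow>\<^sub>M N" "B \<in> sets N"
  shows "measure (PiM V (\<lambda>_. M)) ((\<lambda>\<omega>. g (\<lambda>u\<in>D. \<omega> (f u))) -` B \<inter> space (PiM V (\<lambda>_. M))) =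
    measure (PiM D (\<lambda>_. M)) (g -` B \<inter> space (PiM D (\<lambda>_. M)))"
proof -
  have meas: "(\<lambda>\<omega>. \<lambda>u\<in>D. \<omega> (f u)) \<in> PiM V (\<lambda>_. M) \<rightarrow>\<^sub>M PiM D (\<lambda>_. M)"
    using assms(3) by (auto intro!: measurable_restrict measurable_component_singleton)
  have "distr (PiM V (\<lambda>_. M)) (PiM D (\<lambda>_. M)) (\<lambda>\<omega>. \<lambda>u\<in>D. \<omega> (f u)) = PiM D (\<lambda>_. M)"
    using distr_PiM_reindex[of V "\<lambda>_. M" f D] assms by auto
  then have "measure (PiM D (\<lambda>_. M)) (g -` B \<inter> space (PiM D (\<lambda>_. M))) =
    measure (distr (PiM V (\<lambda>_. M)) (PiM D (\<lambda>_. M)) (\<lambda>\<omega>. \<lambda>u\<in>D. \<omega> (f u)))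
      (g -` B \<inter> space (PiM D (\<lambda>_. M)))"
    by simp
  also have "\<dots> = measure (PiM V (\<lambda>_. M))
      ((\<lambda>\<omega>. \<lambda>u\<in>D. \<omega> (f u)) -` (g -` B \<inter> space (PiM D (\<lambda>_. M))) \<inter> space (PiM V (\<lambda>_. M)))"
    using assms by (intro measure_distr[OF meas]) auto
  also have "(\<lambda>\<omega>. \<lambda>u\<in>D. \<omega> (f u)) -` (g -` B \<inter> space (PiM D (\<lambda>_. M))) \<inter> space (PiM V (\<lambda>_. M)) =
      (\<lambda>\<omega>. g (\<lambda>u\<in>D. \<omega> (f u))) -` B \<inter> space (PiM V (\<lambda>_. M))"
    using measurable_space[OF meas] by auto
  finally show ?thesis by simp
qed

section \<open>Windows of a wheel\<close>

text \<open>The two-way infinite path models the spokeless rim around every \<open>u_is\<close>,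
  with 0 as the centre. One fixed graph yields one common law for all windows.\<close>

definition line :: "int set set" where
  "line = {{j, j + 1} |j. True}"

definition line_init :: "'s \<Rightarrow> 's \<Rightarrow> int \<Rightarrow> 's" where
  "line_init p q j = (if j = 0 then p else q)"

lemma line_iff: "{j, k} \<in> line \<longleftrightarrow> k = j + 1 \<or> k = j - 1"
proof
  assume "k = j + 1 \<or> k = j - 1"
  then show "{j, k} \<in> line"
    unfolding line_def by (auto intro: exI[of _ j] exI[of _ k] simp: insert_commute)
qed (auto simp: line_def doubleton_eq_iff)

text \<open>Here "silent" refers to the verdict: \<open>None\<close> covers runs that have not
  reported "no collision" by time \<open>T\<close>. Equal values other than \<open>None\<close> thus
  mean equal beeping slots and the same negative verdict.\<close>

definition silent_pattern ::
  "('s, 'r) beep_alg \<Rightarrow> 's \<Rightarrow> 's \<Rightarrow> nat \<Rightarrow> (int \<Rightarrow> 'r) \<Rightarrow> bool list option"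
where
  "silent_pattern A p q T \<omega> =
     (if halted_with A line (line_init p q) \<omega> T 0 False
      then Some (map (\<lambda>t. beeps A line (line_init p q) \<omega> t 0) [0..<T]) else None)"

definition patterns :: "nat \<Rightarrow> bool list option set" where
  "patterns T = Some ` {xs. length xs = T}"

lemma finite_patterns: "finite (patterns T)" and card_patterns: "card (patterns T) = 2 ^ T"
  using finite_lists_length_eq[of "UNIV :: bool set" T] card_lists_length_eq[of "UNIV :: bool set" T]
  by (simp_all add: patterns_def card_image)

lemma silent_pattern_in_patterns:
  "silent_pattern A p q T \<omega> \<in> patterns T \<longleftrightarrow>
    halted_with A line (line_init p q) \<omega> T 0 False"
  by (auto simp: silent_pattern_def patterns_def)

lemma silent_pattern_eqD:
  assumes "silent_pattern A p q T \<omega> = silent_pattern A p q T \<omega>'"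
    and "silent_pattern A p q T \<omega> \<in> patterns T" "t < T"
  shows "beeps A line (line_init p q) \<omega> t 0 \<longleftrightarrow> beeps A line (line_init p q) \<omega>' t 0"
  using assms by (auto simp: silent_pattern_def patterns_def split: if_splits)

lemma measurable_silent_pattern:
  assumes "beeping_algorithm A"
  shows "silent_pattern A p q T \<in> PiM V (\<lambda>_. tape A) \<rightarrow>\<^sub>M count_space UNIV"
proof -
  note [measurable] = measurable_halted_with[OF assms] measurable_beeps[OF assms]
  have [measurable]: "(\<lambda>\<omega>. map (\<lambda>t. beeps A line (line_init p q) \<omega> t 0) ts)
      \<in> PiM V (\<lambda>_. tape A) \<rightarrow>\<^sub>M count_space UNIV" for ts
  proof (induction ts)
    case (Cons t ts)
    note [measurable] = this
    show ?case unfolding list.map by measurable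
  qed simp
  show ?thesis unfolding silent_pattern_def[abs_def] by measurable
qed

text \<open>Places the path around \<open>u_is\<close>, with offset 0 at the centre. The computation
  is in the integers because offsets may be negative.\<close>

definition window :: "nat \<Rightarrow> nat \<Rightarrow> nat \<Rightarrow> int \<Rightarrow> nat" where
  "window m s i j = nat ((int (i * s) + j) mod int (4 * m * s))"

context
  fixes m s :: nat
  assumes m: "m > 0" and s: "s > 0"
begin

lemma int_window: "int (window m s i j) = (int (i * s) + j) mod int (4 * m * s)"
  using m s by (simp add: window_def)

lemma window_less: "window m s i j < 4 * m * s"
  using m s int_window[of i j] by (metis of_nat_less_iff pos_mod_bound of_nat_0_less_iff mult_pos_pos zero_less_numeral)

text \<open>Modulo \<open>s\<close> only \<open>j - j'\<close> remains, which is too small to be a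
  nonzero multiple of \<open>s\<close>; cancelling \<open>s\<close>, the same argument applies to
  \<open>i - i'\<close> modulo \<open>4 * m\<close>.\<close>

lemma window_eqD:
  assumes "window m s i j = window m s i' j'" "i < 4 * m" "i' < 4 * m" "\<bar>j - j'\<bar> < int s"
  shows "i = i'" "j = j'"
proof -
  have "(int (i * s) + j) mod int (4 * m * s) = (int (i' * s) + j') mod int (4 * m * s)"
    using assms(1) int_window by metis
  then have dvd: "int (4 * m * s) dvd (int (i * s) + j) - (int (i' * s) + j')"
    by (simp only: mod_eq_dvd_iff)
  have "int s dvd int (i * s) + j - (int (i' * s) + j')"
    by (rule dvd_trans[OF _ dvd]) simp
  also have "\<dots> = (int i - int i') * int s + (j - j')"
    by (simp add: algebra_simps)
  finally have "int s dvd (int i - int i') * int s + (j - j')" .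
  then have "int s dvd j - j'"
    by (simp add: dvd_add_right_iff)
  then show "j = j'"
    using assms(4) zdvd_imp_le[of "int s" "\<bar>j - j'\<bar>"] by (cases "j = j'") auto
  with dvd have "int (4 * m) * int s dvd (int i - int i') * int s"
    by (simp add: algebra_simps)
  then have "int (4 * m) dvd int i - int i'"
    using s by (subst (asm) dvd_mult_cancel_right) auto
  then show "i = i'"
    using assms(2,3) zdvd_imp_le[of "int (4 * m)" "\<bar>int i - int i'\<bar>"] by (cases "i = i'") auto
qed

lemma window_0: "i < 4 * m \<Longrightarrow> window m s i 0 = i * s"
  using s by (simp add: window_def flip: of_nat_mult of_nat_mod)

text \<open>Since \<open>s\<close> divides \<open>4 * m * s\<close>, wrapping around preserves
  divisibility by \<open>s\<close>. So within distance less than \<open>s\<close> only the centre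
  can start in state \<open>p\<close> or carry a spoke.\<close>

lemma dvd_window_iff:
  assumes "\<bar>j\<bar> < int s"
  shows "s dvd window m s i j \<longleftrightarrow> j = 0"
proof -
  have "s dvd window m s i j \<longleftrightarrow> int s dvd (int (i * s) + j) mod int (4 * m * s)"
    unfolding int_window[symmetric] by (simp only: of_nat_dvd_iff)
  also have "\<dots> \<longleftrightarrow> int s dvd j"
    by (simp add: dvd_mod_iff dvd_add_right_iff)
  also have "\<dots> \<longleftrightarrow> j = 0"
    using assms zdvd_imp_le[of "int s" "\<bar>j\<bar>"] by (cases "j = 0") auto
  finally show ?thesis .
qed

lemma wheel_init_dvd:
  assumes "v < 4 * m * s"
  shows "wheel_init p q m s v = (if s dvd v then p else q)"
proof -
  have "(\<exists>i. v = (i * s) mod (4 * m * s) \<and> 1 \<le> i \<and> i \<le> 4 * m) \<longleftrightarrow> s dvd v"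
  proof
    assume "s dvd v"
    then obtain k where k: "v = k * s" by (metis dvd_def mult.commute)
    then have "k < 4 * m" using assms by simp
    show "\<exists>i. v = (i * s) mod (4 * m * s) \<and> 1 \<le> i \<and> i \<le> 4 * m"
    proof (cases "k = 0")
      case True
      \<comment> \<open>Vertex 0 is \<open>u_4ms\<close>: indices start at 1, so its witness is
        \<open>4 * m\<close>.\<close>
      then show ?thesis using k m by (intro exI[of _ "4 * m"]) simp
    next
      case False
      then show ?thesis using k \<open>k < 4 * m\<close> assms by (intro exI[of _ k]) simp
    qed
  next
    assume "\<exists>i. v = (i * s) mod (4 * m * s) \<and> 1 \<le> i \<and> i \<le> 4 * m"
    then show "s dvd v" by (auto simp: dvd_mod_iff)
  qed
  then show ?thesis by (simp add: wheel_init_def)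
qed

lemma odd_spokes_eq:
  "spokes odd m s = {{(2 * k + 1) * s, (2 * k + 1 + 2 * m) * s} | k. k < m}" (is "_ = ?R")
proof -
  have spoke: "{(i * s) mod (4 * m * s), ((i + 2 * m) * s) mod (4 * m * s)} =
      {(2 * k + 1) * s, (2 * k + 1 + 2 * m) * s}" if "i = 2 * k + 1" "k < m" for i k
    using that s by (simp only: mult_mod_left[symmetric]) (simp flip: mult_mod_left)
  show ?thesis
  proof (rule set_eqI, rule iffI)
    fix e assume "e \<in> spokes odd m s"
    then obtain i where i: "1 \<le> i" "i \<le> 2 * m" "odd i"
      "e = {(i * s) mod (4 * m * s), ((i + 2 * m) * s) mod (4 * m * s)}"
      by (auto simp: spokes_def)
    then obtain k where "i = 2 * k + 1" by (elim oddE)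
    with i spoke[of i k] show "e \<in> ?R" by auto
  next
    fix e assume "e \<in> ?R"
    then obtain k where "k < m" "e = {(2 * k + 1) * s, (2 * k + 1 + 2 * m) * s}" by auto
    then show "e \<in> spokes odd m s"
      using spoke[of "2 * k + 1" k] unfolding spokes_def
      by (intro CollectI exI[of _ "2 * k + 1"]) auto
  qed
qed

lemma rim_iff:
  "{v, w} \<in> {{(i - 1) mod (4 * m * s), i mod (4 * m * s)} | i. 1 \<le> i \<and> i \<le> 4 * m * s} \<longleftrightarrow>
    v < 4 * m * s \<and> w < 4 * m * s \<and>
    (w = (v + 1) mod (4 * m * s) \<or> v = (w + 1) mod (4 * m * s))" (is "?L \<longleftrightarrow> ?R")
proof -
  let ?n = "4 * m * s"
  have edge: "{x, (x + 1) mod ?n} \<in>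
      {{(i - 1) mod ?n, i mod ?n} | i. 1 \<le> i \<and> i \<le> ?n}" if "x < ?n" for x
    using that by (intro CollectI exI[of _ "x + 1"]) auto
  show ?thesis
  proof
    assume ?L
    then obtain i where i: "1 \<le> i" "i \<le> ?n" "{v, w} = {(i - 1) mod ?n, i mod ?n}" by blast
    define k where "k = i - 1"
    have "{v, w} = {k, (k + 1) mod ?n}" "k < ?n" using i by (auto simp: k_def)
    then show ?R using m s by (auto simp: doubleton_eq_iff)
  next
    assume ?R
    then show ?L using edge[of v] edge[of w] by (auto simp: insert_commute)
  qed
qed

text \<open>The window is a covering of the rim by the path: rim neighbours of an image are exactly
  the images of neighbours.\<close>

lemma rim_window_iff:
  "{window m s i j, w} \<in>
      {{(i - 1) mod (4 * m * s), i mod (4 * m * s)} | i. 1 \<le> i \<and> i \<le> 4 * m * s} \<longleftrightarrow>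
    w = window m s i (j + 1) \<or> w = window m s i (j - 1)"
proof -
  have succ: "(window m s i j + 1) mod (4 * m * s) = window m s i (j + 1)" for i j
  proof -
    have "int ((window m s i j + 1) mod (4 * m * s)) = int (window m s i (j + 1))"
      unfolding of_nat_mod of_nat_add int_window by (simp add: mod_simps algebra_simps)
    then show ?thesis by simp
  qed
  have pred: "w = window m s i (j - 1)"
    if "w < 4 * m * s" "window m s i j = (w + 1) mod (4 * m * s)"
  proof -
    have "(int (i * s) + j) mod int (4 * m * s) = (int w + 1) mod int (4 * m * s)"
      using arg_cong[OF that(2), of int] unfolding int_window of_nat_mod by (simp add: add.commute)
    then have "(int (i * s) + j - 1) mod int (4 * m * s) = (int w + 1 - 1) mod int (4 * m * s)"
      by (rule mod_diff_cong) simp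
    then have "int w = int (window m s i (j - 1))"
      using that(1) by (simp add: int_window algebra_simps flip: of_nat_mult)
    then show ?thesis by simp
  qed
  show ?thesis
    unfolding rim_iff using window_less succ[of i j] succ[of i "j - 1"] pred by auto
qed

end

section \<open>Errors in odd wheels\<close>

text \<open>Restricting to offsets up to \<open>T\<close> makes this a point of the product over a
  finite index set, and keeps the tapes of different windows on disjoint coordinates.\<close>

definition window_tape :: "nat \<Rightarrow> nat \<Rightarrow> nat \<Rightarrow> (nat \<Rightarrow> 'r) \<Rightarrow> nat \<Rightarrow> int \<Rightarrow> 'r" where
  "window_tape m s T \<omega> i = (\<lambda>j\<in>{- int T..int T}. \<omega> (window m s i j))"

text \<open>The windows in \<open>K\<close> are followed together as the copies in
  \<open>perceived_local\<close>: one window for a vertex without a spoke, two for the ends of a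
  spoke.\<close>

lemma halted_with_wheel_iff:
  assumes m: "m > 0" and s: "s > 0" and T: "T < s" and K: "K \<subseteq> {..<4 * m}" "i \<in> K"
    and match: "\<And>i v. i \<in> K \<Longrightarrow> {i * s, v} \<in> spokes odd m s \<Longrightarrow> \<exists>i'\<in>K. v = i' * s \<and>
      (\<forall>t<T. beeps A line (line_init p q) (window_tape m s T \<omega> i') t 0 \<longleftrightarrow>
             beeps A line (line_init p q) (window_tape m s T \<omega> i) t 0)"
  shows "halted_with A (wheel_edges odd m s) (wheel_init p q m s) \<omega> T (i * s) b \<longleftrightarrow>
    halted_with A line (line_init p q) (window_tape m s T \<omega> i) T 0 b"
proof -
  let ?rim = "{{(i - 1) mod (4 * m * s), i mod (4 * m * s)} | i. 1 \<le> i \<and> i \<le> 4 * m * s}"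
  have init: "wheel_init p q m s (window m s i u) = line_init p q u"
    if "nat \<bar>u\<bar> \<le> T" for i u
  proof -
    have "s dvd window m s i u \<longleftrightarrow> u = 0"
      using that T by (intro dvd_window_iff[OF m s]) simp
    then show ?thesis
      by (subst wheel_init_dvd[OF m s window_less[OF m s]]) (simp add: line_init_def)
  qed
  have tape: "\<omega> (window m s i u) = window_tape m s T \<omega> i u" if "nat \<bar>u\<bar> \<le> T" for i u
    using that by (auto simp: window_tape_def)
  have hist: "perceived A (wheel_edges odd m s) (wheel_init p q m s) \<omega> T (window m s i 0) =
      perceived A line (line_init p q) (window_tape m s T \<omega> i) T 0"
  proof (rule perceived_local[where K = K and d = "\<lambda>u. nat \<bar>u\<bar>" and T = T])
    show "{window m s b u, window m s b u'} \<in> wheel_edges odd m s" if "{u, u'} \<in> line" for b u u'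
      using that rim_window_iff[OF m s, of b u "window m s b u'"]
      by (auto simp: wheel_edges_def line_iff)
    show "(\<exists>u'. {u, u'} \<in> line \<and> w = window m s b u') \<or>
      (\<exists>b'\<in>K. w = window m s b' u \<and>
        (\<forall>t<T. beeps A line (line_init p q) (window_tape m s T \<omega> b') t u =
               beeps A line (line_init p q) (window_tape m s T \<omega> b) t u))"
      if b: "b \<in> K" and "nat \<bar>u\<bar> < T" and e: "{window m s b u, w} \<in> wheel_edges odd m s" for b u w
    proof (cases "{window m s b u, w} \<in> ?rim")
      case True
      then show ?thesis
        unfolding rim_window_iff[OF m s] line_iff by blast
    next
      case False
      then have spoke: "{window m s b u, w} \<in> spokes odd m s"
        using e by (auto simp: wheel_edges_def)
      \<comment> \<open>Spokes end at multiples of \<open>s\<close>, so a spoke can meet the window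
        only at its centre.\<close>
      then have "s dvd window m s b u"
        unfolding odd_spokes_eq[OF m s] by (auto simp: doubleton_eq_iff)
      then have "u = 0"
        using that(2) T dvd_window_iff[OF m s, of u b] by simp
      moreover have "b < 4 * m" using K b by auto
      ultimately obtain b' where "b' \<in> K" "w = b' * s"
        "\<forall>t<T. beeps A line (line_init p q) (window_tape m s T \<omega> b') t 0 \<longleftrightarrow>
             beeps A line (line_init p q) (window_tape m s T \<omega> b) t 0"
        using match[OF b, of w] spoke window_0[OF m s] by auto
      moreover have "window m s b' 0 = b' * s"
        using \<open>b' \<in> K\<close> K window_0[OF m s] by auto
      ultimately show ?thesis using \<open>u = 0\<close> by metis
    qed
  qed (use K init tape in \<open>auto simp: line_iff\<close>)
  have "i * s = window m s i 0" using K window_0[OF m s, of i] by auto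
  then show ?thesis
    using hist init[of 0 i] tape[of 0 i] by (simp add: halted_with_def)
qed

lemma prob_wheel_incorrect_ge:
  assumes alg: "beeping_algorithm A" and m: "m > 0" and s: "2 * T < s"
    and m_large: "2 ^ (T + 2) \<le> m"
    and halts: "prob_wheel_halts (real (Suc T)) A p q odd m s > 3 / 4"
  shows "prob_wheel_incorrect A p q odd m s > 1 / 4"
proof -
  let ?V = "wheel_verts m s" and ?E = "wheel_edges odd m s" and ?ini = "wheel_init p q m s"
  let ?C = "\<Union> (spokes odd m s)"
  let ?n = "4 * m * s" and ?D = "{- int T..int T}"
  have s0: "s > 0" using s by simp
  have Vn: "?V = {..<?n}" by (simp add: wheel_verts_def)
  have ps: "prob_space (tape A)" using alg by (simp add: beeping_algorithm_def)
  define M where "M = PiM ?V (\<lambda>_. tape A)"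
  interpret M: prob_space M unfolding M_def by (intro prob_space_PiM ps)
  have halted_ev [measurable]: "Measurable.pred M (\<lambda>\<omega>. halted_with A ?E ?ini \<omega> t v b)" for t v b
    unfolding M_def by (rule measurable_halted_with[OF alg])
  define H where "H b = {\<omega>\<in>space M. halted_with A ?E ?ini \<omega> T 0 b}" for b
  define Bad where "Bad = {\<omega>\<in>space M. some_incorrect_result ?C A ?V ?E ?ini \<omega>}"
  have H_ev: "H b \<in> M.events" for b unfolding H_def by measurable
  have Bad_ev: "Bad \<in> M.events" unfolding Bad_def some_incorrect_result_def by measurable
  have incorrect: "prob_wheel_incorrect A p q odd m s = M.prob Bad"
    by (simp add: prob_wheel_incorrect_def Bad_def M_def choices_def)
  \<comment> \<open>Vertex 0 lies on no spoke of an odd wheel; it serves as the test vertex, where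
    the verdict \<open>True\<close> is an error.\<close>
  have "0 \<notin> ?C"
    using s0 by (auto simp: odd_spokes_eq[OF m s0])
  then have H_True: "H True \<subseteq> Bad"
    using m s0 by (auto simp: H_def Bad_def some_incorrect_result_def Vn intro!: bexI[of _ 0] exI[of _ T])
  have "prob_wheel_halts (real (Suc T)) A p q odd m s \<le> M.prob (H True \<union> H False)"
    unfolding prob_wheel_halts_def choices_def M_def[symmetric]
  proof (rule M.finite_measure_mono)
    show "{\<omega>\<in>space M. halts_in_less_than (real (Suc T)) A ?V ?E ?ini \<omega>} \<subseteq> H True \<union> H False"
    proof
      fix \<omega> assume "\<omega> \<in> {\<omega>\<in>space M. halts_in_less_than (real (Suc T)) A ?V ?E ?ini \<omega>}"
      then obtain t where "\<omega> \<in> space M" "real t < real (Suc T)"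
        and "\<forall>v\<in>?V. \<exists>b. halted_with A ?E ?ini \<omega> t v b"
        by (auto simp: halts_in_less_than_def)
      moreover have "0 \<in> ?V" using m s0 by (simp add: Vn)
      ultimately obtain b where "\<omega> \<in> space M" "t \<le> T" "halted_with A ?E ?ini \<omega> t 0 b"
        by force
      then have "\<omega> \<in> H b" using halted_with_mono unfolding H_def by fast
      then show "\<omega> \<in> H True \<union> H False" by (cases b) auto
    qed
  qed (use H_ev in auto)
  also have "\<dots> \<le> M.prob (H True) + M.prob (H False)"
    using H_ev by (intro measure_Un_le)
  finally have H_sum: "M.prob (H True) + M.prob (H False) > 3 / 4" using halts by simp

  show ?thesis
  proof (cases "M.prob (H True) > 1 / 4")
    case True
    then show ?thesis using M.finite_measure_mono[OF H_True Bad_ev] incorrect by simp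
  next
    case False
    then have H_False: "M.prob (H False) > 1 / 2" using H_sum by simp
    let ?I = "{..<4 * m}"
    define Q where "Q = PiM ?D (\<lambda>_. tape A)"
    interpret Q: prob_space Q unfolding Q_def by (intro prob_space_PiM ps)
    define X where "X i \<omega> = silent_pattern A p q T (window_tape m s T \<omega> i)" for i \<omega>
    define \<mu> where "\<mu> \<sigma> = Q.prob (silent_pattern A p q T -` {\<sigma>} \<inter> space Q)" for \<sigma>
    have sp: "silent_pattern A p q T \<in> Q \<rightarrow>\<^sub>M count_space UNIV"
      unfolding Q_def by (rule measurable_silent_pattern[OF alg])
    have win: "window m s i ` ?D \<subseteq> ?V" for i
      using window_less[OF m s0] by (auto simp: Vn)
    have inj: "inj_on (window m s i) ?D" if "i < 4 * m" for i
      by (rule inj_onI, rule window_eqD(2)[OF m s0]) (use that s in auto)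
    have prob_X: "M.prob (X i -` B \<inter> space M) = Q.prob (silent_pattern A p q T -` B \<inter> space Q)"
      if "i < 4 * m" for i B
      using prob_window[OF ps inj[OF that] win, of "silent_pattern A p q T" "count_space UNIV" B]
        sp by (simp add: X_def[abs_def] window_tape_def M_def Q_def)
    have "0 \<in> ?V" using m s0 by (simp add: Vn)
    then have "?V \<noteq> {}" by blast
    moreover have "disjoint_family_on (\<lambda>i. window m s i ` ?D) ?I"
      unfolding disjoint_family_on_def
    proof (intro ballI impI, rule ccontr)
      fix i i' assume i: "i \<in> ?I" "i' \<in> ?I" "i \<noteq> i'"
        and "window m s i ` ?D \<inter> window m s i' ` ?D \<noteq> {}"
      then obtain j j' where "j \<in> ?D" "j' \<in> ?D" "window m s i j = window m s i' j'" by blast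
      \<comment> \<open>Offsets in \<open>?D\<close> differ by at most \<open>2 * T\<close>, which
        is below \<open>s\<close>.\<close>
      moreover from this s have "\<bar>j - j'\<bar> < int s" by auto
      ultimately show False using window_eqD(1)[OF m s0, of i j i' j'] i by auto
    qed
    ultimately have "M.indep_vars (\<lambda>_. Q) (\<lambda>i \<omega>. window_tape m s T \<omega> i) ?I"
      unfolding window_tape_def M_def Q_def by (intro indep_vars_windows ps win)
    then have indep: "M.indep_vars (\<lambda>_. count_space UNIV) X ?I"
      unfolding X_def by (rule M.indep_vars_compose2) (rule sp)

    let ?a = "\<lambda>k. 2 * k + 1" and ?b = "\<lambda>k. 2 * k + 1 + 2 * m"
    \<comment> \<open>\<open>x\<close> is the probability that two independent spokeless runs both
      report "no collision" with the same beeping slots.\<close>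
    define x where "x = (\<Sum>\<sigma>\<in>patterns T. (\<mu> \<sigma>)\<^sup>2)"
    define Agree where "Agree = {\<omega>\<in>space M. \<exists>k\<in>{..<m}. X (?a k) \<omega> = X (?b k) \<omega> \<and> X (?a k) \<omega> \<in> patterns T}"
    have "M.prob Agree = 1 - (1 - x) ^ card {..<m}"
      unfolding Agree_def x_def
    proof (rule M.prob_some_pair_agrees[OF indep])
      show "disjoint_family_on (\<lambda>k. {?a k, ?b k}) {..<m}"
        unfolding disjoint_family_on_def by auto
    qed (use prob_X in \<open>auto simp: finite_patterns \<mu>_def\<close>)
    then have Agree: "M.prob Agree = 1 - (1 - x) ^ m" by simp

    have cancel: "i * s = j * s \<longleftrightarrow> i = j" for i j
      using s0 by simp
    have "Agree \<subseteq> Bad"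
    proof
      fix \<omega> assume "\<omega> \<in> Agree"
      then obtain k where \<omega>: "\<omega> \<in> space M" and k: "k < m" "X (?a k) \<omega> = X (?b k) \<omega>"
        and pat: "X (?a k) \<omega> \<in> patterns T"
        unfolding Agree_def by blast
      have "halted_with A ?E ?ini \<omega> T (?a k * s) False \<longleftrightarrow>
          halted_with A line (line_init p q) (window_tape m s T \<omega> (?a k)) T 0 False"
      proof (rule halted_with_wheel_iff[OF m s0, where K = "{?a k, ?b k}"])
        show "\<exists>i'\<in>{?a k, ?b k}. v = i' * s \<and>
            (\<forall>t<T. beeps A line (line_init p q) (window_tape m s T \<omega> i') t 0 \<longleftrightarrow>
                   beeps A line (line_init p q) (window_tape m s T \<omega> i) t 0)"
          if i: "i \<in> {?a k, ?b k}" and "{i * s, v} \<in> spokes odd m s" for i v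
        proof -
          have "{i * s, v} = {?a k * s, ?b k * s}"
          proof -
            obtain l where l: "l < m" "{i * s, v} = {?a l * s, ?b l * s}"
              using \<open>{i * s, v} \<in> spokes odd m s\<close> unfolding odd_spokes_eq[OF m s0] by blast
            then have "i * s = ?a l * s \<or> i * s = ?b l * s"
              unfolding doubleton_eq_iff by blast
            then have "i = ?a l \<or> i = ?b l" unfolding cancel .
            \<comment> \<open>Of the two ends of a spoke, one index is below \<open>2 * m\<close>
              and the other above, so either end determines the spoke.\<close>
            then have "l = k" using i l(1) k(1) by auto
            with l show ?thesis by simp
          qed
          then have "v = ?a k * s \<and> i = ?b k \<or> v = ?b k * s \<and> i = ?a k"
            unfolding doubleton_eq_iff cancel by blast
          then show ?thesis
            using silent_pattern_eqD[OF k(2)[unfolded X_def] pat[unfolded X_def]] by auto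
        qed
      qed (use k(1) s in auto)
      then have "halted_with A ?E ?ini \<omega> T (?a k * s) False"
        using pat by (simp add: X_def silent_pattern_in_patterns)
      moreover have "?a k * s \<in> ?C"
        using k(1) unfolding odd_spokes_eq[OF m s0] by blast
      moreover have "?a k * s \<in> ?V"
        using k(1) s0 unfolding Vn lessThan_iff mult_less_cancel2 by simp
      ultimately show "\<omega> \<in> Bad"
        using \<omega> unfolding Bad_def some_incorrect_result_def by blast
    qed

    have "H False = X 0 -` patterns T \<inter> space M"
    proof -
      have "0 \<notin> e" if "e \<in> spokes odd m s" for e using \<open>0 \<notin> ?C\<close> that by blast
      then have "{0, v} \<notin> spokes odd m s" for v by blast
      \<comment> \<open>With \<open>K = {0}\<close> the matching condition is vacuous.\<close>
      then have "halted_with A ?E ?ini \<omega> T (0 * s) False \<longleftrightarrow>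
          halted_with A line (line_init p q) (window_tape m s T \<omega> 0) T 0 False" for \<omega>
        using m s by (intro halted_with_wheel_iff[OF m s0, where K = "{0}"]) auto
      then have "halted_with A ?E ?ini \<omega> T 0 False \<longleftrightarrow> X 0 \<omega> \<in> patterns T" for \<omega>
        unfolding X_def silent_pattern_in_patterns mult_0 .
      then show ?thesis
        unfolding H_def by blast
    qed
    \<comment> \<open>The common law \<open>Q\<close> carries the bound from the spokeless vertex 0
      over to the path runs at the spoke ends.\<close>
    then have "M.prob (H False) = Q.prob (silent_pattern A p q T -` patterns T \<inter> space Q)"
      using prob_X[of 0 "patterns T"] m by simp
    also have "silent_pattern A p q T -` patterns T \<inter> space Q =
        (\<Union>\<sigma>\<in>patterns T. silent_pattern A p q T -` {\<sigma>} \<inter> space Q)" by auto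
    also have "Q.prob \<dots> = (\<Sum>\<sigma>\<in>patterns T. \<mu> \<sigma>)"
      unfolding \<mu>_def using sp finite_patterns
      by (intro Q.finite_measure_finite_Union)
        (auto simp: disjoint_family_on_def intro: measurable_sets)
    finally have sum_\<mu>: "M.prob (H False) = (\<Sum>\<sigma>\<in>patterns T. \<mu> \<sigma>)" .
    \<comment> \<open>Cauchy-Schwarz over the \<open>2 ^ T\<close> patterns:
      \<open>1/4 \<le> 2^T x\<close>.\<close>
    then have "(1 / 2)\<^sup>2 \<le> (\<Sum>\<sigma>\<in>patterns T. \<mu> \<sigma>)\<^sup>2"
      using H_False by (intro power_mono) auto
    also have "\<dots> \<le> x * 2 ^ T"
      using sum_squared_le_sum_of_squares[of \<mu> "patterns T"]
      by (simp add: x_def card_patterns)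
    finally have "1 \<le> 2 ^ (T + 2) * x"
      by (simp add: power2_eq_square power_add field_simps)
    also have "\<dots> \<le> real m * x"
    proof (rule mult_right_mono)
      show "2 ^ (T + 2) \<le> real m"
        using m_large by (metis of_nat_le_iff of_nat_numeral of_nat_power)
    qed (simp add: x_def sum_nonneg)
    finally have mx: "1 \<le> real m * x" .
    have "0 \<le> x" by (simp add: x_def sum_nonneg)
    moreover have "x \<le> 1"
    proof -
      have "x \<le> (\<Sum>\<sigma>\<in>patterns T. \<mu> \<sigma>)"
        unfolding x_def by (intro sum_mono) (auto simp: \<mu>_def power2_eq_square mult_left_le)
      then show ?thesis using sum_\<mu> M.prob_le_1[of "H False"] by simp
    qed
    ultimately have "(1 - x) ^ m \<le> 1 / 2"
      using mx by (rule one_minus_power_le_half)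
    then show ?thesis
      using Agree M.finite_measure_mono[OF \<open>Agree \<subseteq> Bad\<close> Bad_ev] incorrect by simp
  qed
qed

theorem theorem1:
  fixes A :: "('s, 'r) beep_alg"
    and wishes :: "'s \<Rightarrow> bool"
    and p q :: "nat \<Rightarrow> 's"
    and n0 :: nat
  assumes alg: "beeping_algorithm A"
    and wish: "\<And>n. wishes (p n)"
    and no_wish: "\<And>n. \<not> wishes (q n)"
    and fast: "\<And>n m s par. n \<ge> n0 \<Longrightarrow> m > 0 \<Longrightarrow> s > 0 \<Longrightarrow> n = 4 * m * s \<Longrightarrow> par \<in> {odd, even} \<Longrightarrow>
      prob_wheel_halts (log 2 (real n) / 2) A (p n) (q n) par m s > 3 / 4"
  shows "\<exists>n m s par. n \<ge> n0 \<and> m > 0 \<and> s > 0 \<and> n = 4 * m * s \<and> par \<in> {odd, even} \<and>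
      prob_wheel_incorrect A (p n) (q n) par m s > 1 / 4"
proof -
  \<comment> \<open>Taking \<open>s\<close> a power of two makes \<open>m = 2^s / (4 s)\<close> an
    integer, so \<open>log n = s\<close> and \<open>(log n)/2 = Suc T\<close> exactly. The summand 4
    makes \<open>s\<close> large enough for \<open>a + 4 \<le> s/2\<close>; this keeps the exponent
    of \<open>m\<close> from being truncated and gives \<open>T + 2 \<le> s - a - 2\<close>.\<close>
  define a where "a = n0 + 4"
  define s :: nat where "s = 2 ^ a"
  define T where "T = 2 ^ (a - 1) - (1 :: nat)"
  define m :: nat where "m = 2 ^ (s - a - 2)"
  have half: "a + 4 \<le> 2 ^ (a - 1)"
  proof -
    have "2 ^ (a - 1) = 8 * (2 :: nat) ^ n0" by (simp add: a_def power_add)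
    then show ?thesis using less_exp[of n0] unfolding a_def by linarith
  qed
  have s: "s = 2 * 2 ^ (a - 1)"
    unfolding s_def by (simp add: a_def flip: power_Suc)
  have T: "Suc T = 2 ^ (a - 1)"
    by (simp add: T_def)
  have sT: "s = 2 * Suc T" using s T by simp
  have n: "4 * m * s = 2 ^ s"
  proof -
    have "4 * m * s = 2 ^ (2 + (s - a - 2) + a)"
      unfolding m_def power_add by (simp add: s_def)
    also have "2 + (s - a - 2) + a = s"
      using half s by simp
    finally show ?thesis .
  qed
  have log: "log 2 (real (2 ^ s)) / 2 = real (Suc T)"
  proof -
    have "log 2 (real (2 ^ s)) = real s" by (simp add: log_nat_power)
    then show ?thesis using sT by simp
  qed
  have n0: "2 ^ s \<ge> n0"
  proof -
    have "n0 < s" using half s unfolding a_def by linarith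
    also have "s < 2 ^ s" by (rule less_exp)
    finally show ?thesis by simp
  qed
  have pos: "m > 0" "s > 0" by (simp_all add: m_def s_def)
  have halts: "prob_wheel_halts (real (Suc T)) A (p (2 ^ s)) (q (2 ^ s)) odd m s > 3 / 4"
    using fast[OF n0 pos n[symmetric], of odd] unfolding log by blast
  have m_large: "2 ^ (T + 2) \<le> m"
    unfolding m_def using half s T by (intro power_increasing) auto
  have "2 * T < s" using sT by simp
  then have "prob_wheel_incorrect A (p (2 ^ s)) (q (2 ^ s)) odd m s > 1 / 4"
    using prob_wheel_incorrect_ge[OF alg pos(1) _ m_large halts] by blast
  then show ?thesis
    using n0 pos n by (intro exI[of _ "2 ^ s"] exI[of _ m] exI[of _ s] exI[of _ odd]) auto
qed

end
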